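(* Let $t\geq 2$ and let $m_1,m_2$ and $n_1,\ldots,n_t$ be positive integers such that $m_2\geq n_i\geq 2 \lceil \log (35^{2^{t}-2}(32m_1+49m_2))\rceil+2$ for each $1\leq i\leq t$. Then $$R(C_{n_1},\ldots,C_{n_t},K_{m_1,m_2})\leq 35^{2^{t}-2}(32m_1+49m_2).$$
   Context: $C_k$ denotes the cycle on $k$ vertices and $K_{a,b}$ the complete bipartite graph with parts of sizes $a$ and $b$. For graphs $G_1,\ldots,G_k$, the Ramsey number $R(G_1,\ldots,G_k)$ is the smallest integer $N$ such that for every coloring of the edges of the complete graph $K_N$ with colors $1,\ldots,k$ there is, for some $i$, a copy of $G_i$ all of whose edges have color $i$. $\log$ denotes the logarithm to base $2$. *)

theory Defs
  imports Complex_Main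
begin

text \<open>A (simple) graph is given by a vertex set and a symmetric edge predicate.\<close>
type_synonym graph = "nat set \<times> (nat \<Rightarrow> nat \<Rightarrow> bool)"

definition cycle_graph :: "nat \<Rightarrow> graph" where
  "cycle_graph n = ({..<n}, (\<lambda>u v. u \<noteq> v \<and> (v = (u + 1) mod n \<or> u = (v + 1) mod n)))"

definition complete_bipartite :: "nat \<Rightarrow> nat \<Rightarrow> graph" where
  "complete_bipartite a b = ({..<a+b}, (\<lambda>u v. (u < a \<and> a \<le> v) \<or> (v < a \<and> a \<le> u)))"

text \<open>An edge colouring of K_N (vertices {..<N}) is a map from 2-sets to colours.
  The colouring c contains a copy of G all of whose edges have colour i.\<close>
definition has_mono_copy :: "nat \<Rightarrow> (nat set \<Rightarrow> nat) \<Rightarrow> graph \<Rightarrow> nat \<Rightarrow> bool" where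
  "has_mono_copy N c G i \<longleftrightarrow>
     (\<exists>f. inj_on f (fst G) \<and> f ` fst G \<subseteq> {..<N} \<and>
          (\<forall>u\<in>fst G. \<forall>v\<in>fst G. snd G u v \<longrightarrow> c {f u, f v} = i))"

definition ramsey_prop :: "graph list \<Rightarrow> nat \<Rightarrow> bool" where
  "ramsey_prop Gs N \<longleftrightarrow>
     (\<forall>c. (\<forall>x<N. \<forall>y<N. x \<noteq> y \<longrightarrow> c {x, y} < length Gs) \<longrightarrow>
          (\<exists>i<length Gs. has_mono_copy N c (Gs ! i) i))"

definition ramsey_number :: "graph list \<Rightarrow> nat" where
  "ramsey_number Gs = (LEAST N. ramsey_prop Gs N)"

end

theory Submission
  imports Defs
begin

text \<open>
  By induction on the number \<open>t\<close> of symmetric relations (the cycle colours), a set of at least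
  \<open>threshold t * m\<close> vertices contains a cycle of the desired length in one of the relations, or a
  complete bipartite graph with parts of size \<open>m\<close> whose edges avoid all of them. In the step, the
  induction hypothesis for the first \<open>t\<close> relations, with \<open>m\<close> enlarged, yields large sets \<open>A\<close>,
  \<open>B\<close> between which these relations do not hold; we may assume that the next relation holds
  somewhere between any \<open>m\<close>-subset of \<open>A\<close> and any \<open>m\<close>-subset of \<open>B\<close>.

  In such a bipartite graph, after deletion of at most \<open>2 * m\<close> exceptional vertices, any two
  vertices \<open>x\<close>, \<open>y\<close> are joined by paths of every admissible length of the right parity: grow
  disjoint binary trees from \<open>x\<close> and \<open>y\<close> until they have \<open>m\<close> leaves, find a long path in the rest
  by depth-first search, and choose a segment of it of the right length whose ends are adjacent to
  leaves of the two trees. A cycle of even length is closed by an edge between \<open>A\<close> and \<open>B\<close>. A cycle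
  of odd length is closed by an edge inside \<open>A\<close>, which exists by the induction hypothesis applied
  a second time, inside \<open>A\<close>; hence the squaring in the recursion for the threshold.
\<close>

section \<open>Paths and cycles\<close>

definition simple_path :: "('a \<Rightarrow> 'a \<Rightarrow> bool) \<Rightarrow> 'a list \<Rightarrow> bool" where
  "simple_path E p \<longleftrightarrow> distinct p \<and> successively E p"

text \<open>The length \<open>n\<close> counts the vertices of the path, not its edges.\<close>
definition joined :: "('a \<Rightarrow> 'a \<Rightarrow> bool) \<Rightarrow> 'a set \<Rightarrow> nat \<Rightarrow> 'a \<Rightarrow> 'a \<Rightarrow> bool" where
  "joined E S n x y \<longleftrightarrow>
     (\<exists>p. p \<noteq> [] \<and> simple_path E p \<and> set p \<subseteq> S \<and> length p = n \<and> hd p = x \<and> last p = y)"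

definition contains_cycle :: "('a \<Rightarrow> 'a \<Rightarrow> bool) \<Rightarrow> 'a set \<Rightarrow> nat \<Rightarrow> bool" where
  "contains_cycle E V n \<longleftrightarrow> (\<exists>x y. joined E V n x y \<and> E y x)"

lemma joined_refl: "x \<in> S \<Longrightarrow> joined E S (Suc 0) x x"
  by (auto simp: joined_def simple_path_def intro!: exI[of _ "[x]"])

lemma joined_mono:
  assumes "joined E S n x y" "S \<subseteq> T" "\<And>u v. E u v \<Longrightarrow> F u v"
  shows "joined F T n x y"
proof -
  obtain p where p: "p \<noteq> []" "simple_path E p" "set p \<subseteq> S" "length p = n" "hd p = x" "last p = y"
    using assms(1) unfolding joined_def by blast
  then have "simple_path F p"
    using assms(3) by (auto simp: simple_path_def intro: successively_mono)
  then show ?thesis using p assms(2) unfolding joined_def by blast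
qed

lemma joined_sym:
  assumes "symp E" "joined E S n x y"
  shows "joined E S n y x"
proof -
  obtain p where p: "p \<noteq> []" "simple_path E p" "set p \<subseteq> S" "length p = n" "hd p = x" "last p = y"
    using assms(2) unfolding joined_def by blast
  then have "simple_path E (rev p)"
    using assms(1) by (auto simp: simple_path_def intro: successively_mono sympD)
  then show ?thesis
    using p unfolding joined_def by (intro exI[of _ "rev p"]) (auto simp: hd_rev last_rev)
qed

lemma joined_append:
  assumes "joined E S k x u" "E u v" "joined E T l v y" "S \<inter> T = {}"
  shows "joined E (S \<union> T) (k + l) x y"
proof -
  obtain p where p: "p \<noteq> []" "simple_path E p" "set p \<subseteq> S" "length p = k" "hd p = x" "last p = u"
    using assms(1) unfolding joined_def by blast
  obtain q where q: "q \<noteq> []" "simple_path E q" "set q \<subseteq> T" "length q = l" "hd q = v" "last q = y"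
    using assms(3) unfolding joined_def by blast
  have "simple_path E (p @ q)"
    using p q assms(2,4) by (auto simp: simple_path_def successively_append_iff)
  then show ?thesis
    using p q unfolding joined_def by (intro exI[of _ "p @ q"]) auto
qed

lemma joined_segment:
  assumes "simple_path E p" "i + r < length p"
  shows "joined E (set p) (Suc r) (p ! i) (p ! (i + r))"
proof -
  let ?q = "take (Suc r) (drop i p)"
  have len: "length ?q = Suc r" using assms(2) by simp
  then have "?q \<noteq> []" by auto
  moreover have "hd ?q = p ! i" "last ?q = p ! (i + r)"
    using len assms(2) \<open>?q \<noteq> []\<close> by (auto simp: hd_conv_nth last_conv_nth)
  moreover have "simple_path E ?q"
    using assms by (auto simp: simple_path_def successively_conv_nth)
  moreover have "set ?q \<subseteq> set p" by (meson order_trans set_drop_subset set_take_subset)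
  ultimately show ?thesis using len unfolding joined_def by blast
qed

lemma contains_cycle_mono:
  assumes "contains_cycle E S n" "S \<subseteq> T" "\<And>u v. E u v \<Longrightarrow> F u v"
  shows "contains_cycle F T n"
proof -
  obtain x y where xy: "joined E S n x y" "E y x"
    using assms(1) unfolding contains_cycle_def by blast
  have "joined F T n x y" using xy(1) assms(2,3) by (rule joined_mono)
  with assms(3)[OF xy(2)] show ?thesis unfolding contains_cycle_def by blast
qed

text \<open>Depth-first search: \<open>p\<close> is the current stack and \<open>D\<close> the set of vertices that have been
  popped. Every step either pushes or pops a vertex, so \<open>2 * card D + length p\<close> counts the steps.\<close>
definition dfs_state :: "('a \<Rightarrow> 'a \<Rightarrow> bool) \<Rightarrow> 'a set \<Rightarrow> 'a set \<Rightarrow> 'a list \<Rightarrow> bool" where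
  "dfs_state E V D p \<longleftrightarrow> simple_path E p \<and> D \<subseteq> V \<and> set p \<subseteq> V - D \<and>
     (\<forall>x\<in>D. \<forall>u\<in>V - D - set p. \<not> E x u)"

lemma dfs_state_step:
  assumes "finite V" "symp E" and state: "dfs_state E V D p" and "u \<in> V - D - set p"
  shows "\<exists>D' p'. dfs_state E V D' p' \<and> 2 * card D' + length p' = Suc (2 * card D + length p)"
proof (cases p)
  case Nil
  then have "dfs_state E V D [u]"
    using assms by (auto simp: dfs_state_def simple_path_def)
  then show ?thesis using Nil by (intro exI[of _ D] exI[of _ "[u]"]) simp
next
  case (Cons v q)
  show ?thesis
  proof (cases "\<exists>w\<in>V - D - set p. E v w")
    case True
    then obtain w where w: "w \<in> V - D - set p" "E v w" by blast
    then have "dfs_state E V D (w # p)"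
      using state Cons sympD[OF assms(2) w(2)]
      by (auto simp: dfs_state_def simple_path_def)
    then show ?thesis by (intro exI[of _ D] exI[of _ "w # p"]) simp
  next
    case False
    have "finite D" using state assms(1) by (auto simp: dfs_state_def intro: finite_subset)
    moreover have "v \<notin> D" using state Cons by (auto simp: dfs_state_def)
    moreover have "dfs_state E V (insert v D) q"
      using state Cons False by (auto simp: dfs_state_def simple_path_def successively_Cons)
    ultimately show ?thesis
      using Cons by (intro exI[of _ "insert v D"] exI[of _ q]) simp
  qed
qed

lemma card_dfs_unvisited:
  assumes "finite V" "dfs_state E V D p"
  shows "card (V - D - set p) + card D + length p = card V"
proof -
  have D: "D \<subseteq> V" "set p \<subseteq> V - D" "distinct p"
    using assms(2) by (auto simp: dfs_state_def simple_path_def)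
  have "finite D" using D(1) assms(1) by (rule finite_subset)
  then have "card (V - D) + card D = card V"
    using D(1) assms(1) by (simp add: card_Diff_subset card_mono)
  moreover have "card (V - D - set p) + length p = card (V - D)"
    using D(2,3) assms(1) by (simp add: card_Diff_subset distinct_card[symmetric] card_mono)
  ultimately show ?thesis by simp
qed

lemma ex_dfs_state:
  assumes "finite V" "symp E" "k \<le> card V"
  shows "\<exists>D p. dfs_state E V D p \<and> 2 * card D + length p = k"
  using assms(3)
proof (induction k)
  case 0
  show ?case
    by (intro exI[of _ "{}"] exI[of _ "[]"]) (simp add: dfs_state_def simple_path_def)
next
  case (Suc k)
  then obtain D p where D: "dfs_state E V D p" "2 * card D + length p = k" by auto
  then have "0 < card (V - D - set p)"
    using card_dfs_unvisited[OF assms(1) D(1)] Suc.prems by linarith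
  then obtain u where "u \<in> V - D - set p" by (metis card_gt_0_iff ex_in_conv)
  from dfs_state_step[OF assms(1,2) D(1) this] show ?case by (simp add: D(2))
qed

lemma ex_path_balanced_separation:
  assumes "finite V" "symp E"
  obtains p D U where "simple_path E p" "set p \<subseteq> V" "D \<subseteq> V" "U \<subseteq> V"
    "V \<subseteq> D \<union> U \<union> set p" "card D = card U" "\<And>x u. \<lbrakk>x \<in> D; u \<in> U\<rbrakk> \<Longrightarrow> \<not> E x u"
proof -
  obtain D p where state: "dfs_state E V D p" and "2 * card D + length p = card V"
    using ex_dfs_state[OF assms order_refl] by blast
  then have "card D = card (V - D - set p)"
    using card_dfs_unvisited[OF assms(1) state] by linarith
  then show thesis
    using state by (intro that[of p D "V - D - set p"]) (auto simp: dfs_state_def)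
qed

section \<open>Expansion and binary trees\<close>

locale finite_graph =
  fixes V :: "'a set" and E :: "'a \<Rightarrow> 'a \<Rightarrow> bool"
  assumes finite_vertices: "finite V" and symp_edges: "symp E"
    and edge_in_vertices: "E u v \<Longrightarrow> u \<in> V"
begin

definition nbrs :: "'a set \<Rightarrow> 'a set" where
  "nbrs X = {v. \<exists>x\<in>X. E x v}"

definition expanding :: "nat \<Rightarrow> nat \<Rightarrow> 'a set \<Rightarrow> bool" where
  "expanding k m W \<longleftrightarrow> (\<forall>S\<subseteq>V - W. card S \<le> m \<longrightarrow> k * card S \<le> card (nbrs S - (W \<union> S)))"

lemma edge_sym: "E u v \<Longrightarrow> E v u"
  using symp_edges by (rule sympD)

lemma nbrs_subset: "nbrs X \<subseteq> V"
  using edge_in_vertices edge_sym by (auto simp: nbrs_def)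

lemma finite_nbrs: "finite (nbrs X)"
  using nbrs_subset finite_vertices by (rule finite_subset)

lemma finite_if_subset_vertices: "X \<subseteq> V \<Longrightarrow> finite X"
  using finite_vertices by (rule finite_subset[rotated])

lemma card_outer_nbrs_Un:
  "card (nbrs (X \<union> Y) - (X \<union> Y)) \<le> card (nbrs X - X) + card (nbrs Y - (X \<union> Y))"
proof -
  have "nbrs (X \<union> Y) - (X \<union> Y) \<subseteq> (nbrs X - X) \<union> (nbrs Y - (X \<union> Y))"
    by (auto simp: nbrs_def)
  then have "card (nbrs (X \<union> Y) - (X \<union> Y)) \<le> card ((nbrs X - X) \<union> (nbrs Y - (X \<union> Y)))"
    by (intro card_mono) (auto simp: finite_nbrs)
  also have "\<dots> \<le> card (nbrs X - X) + card (nbrs Y - (X \<union> Y))" by (rule card_Un_le)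
  finally show ?thesis .
qed

lemma card_nbrs_le:
  assumes "finite X"
  shows "card (nbrs X) \<le> card (nbrs X - X) + card X"
  using diff_card_le_card_Diff[OF assms, of "nbrs X"] by linarith

text \<open>A largest set \<open>W\<close> with \<open>card W \<le> a\<close> and few outer neighbours works: a non-expanding \<open>S\<close>
  could be added to \<open>W\<close>.\<close>
lemma ex_expanding:
  assumes large: "\<And>X. \<lbrakk>X \<subseteq> V; a < card X; card X \<le> a + m\<rbrakk> \<Longrightarrow> Suc k * card X < card (nbrs X)"
  obtains W where "W \<subseteq> V" "card W \<le> a" "expanding k m W"
proof -
  define narrow where
    "narrow W \<longleftrightarrow> W \<subseteq> V \<and> card W \<le> a \<and> card (nbrs W - W) \<le> k * card W" for W
  have "narrow {}" by (simp add: narrow_def nbrs_def)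
  then obtain W where W: "narrow W" and maximal: "\<And>W'. narrow W' \<Longrightarrow> card W' \<le> card W"
    using ex_has_greatest_nat[of narrow "{}" card "Suc a"] by (auto simp: narrow_def less_Suc_eq_le)
  have "k * card S \<le> card (nbrs S - (W \<union> S))" if S: "S \<subseteq> V - W" "card S \<le> m" for S
  proof (rule ccontr)
    assume "\<not> ?thesis"
    then have few: "card (nbrs S - (W \<union> S)) < k * card S" by simp
    have WS: "W \<union> S \<subseteq> V" "finite W" "finite S"
      using S W finite_if_subset_vertices by (auto simp: narrow_def)
    have card_WS: "card (W \<union> S) = card W + card S"
      using S WS by (intro card_Un_disjoint) auto
    have "card S \<noteq> 0" using few by (metis mult_0_right not_less_zero)
    then have "\<not> narrow (W \<union> S)" using maximal[of "W \<union> S"] card_WS by auto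
    moreover have outer: "card (nbrs (W \<union> S) - (W \<union> S)) \<le> k * card (W \<union> S)"
      using card_outer_nbrs_Un[of W S] few W card_WS by (simp add: narrow_def distrib_left)
    ultimately have "a < card (W \<union> S)" using WS by (auto simp: narrow_def)
    then have "Suc k * card (W \<union> S) < card (nbrs (W \<union> S))"
      using WS S W card_WS by (intro large) (auto simp: narrow_def)
    then show False using card_nbrs_le[of "W \<union> S"] outer WS by simp
  qed
  then have "expanding k m W" by (simp add: expanding_def)
  with W show thesis by (intro that[of W]) (simp_all add: narrow_def)
qed

text \<open>All that is needed of a complete binary tree of height \<open>j\<close> with root \<open>x\<close>, vertex set \<open>S\<close>
  and set of leaves \<open>L\<close>.\<close>
definition doubling_tree :: "'a \<Rightarrow> nat \<Rightarrow> 'a set \<Rightarrow> 'a set \<Rightarrow> bool" where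
  "doubling_tree x j S L \<longleftrightarrow> finite S \<and> card S < 2 ^ Suc j \<and> L \<subseteq> S \<and> card L = 2 ^ j \<and>
     (\<forall>u\<in>L. joined E S (Suc j) x u)"

lemma doubling_tree_0: "doubling_tree x 0 {x} {x}"
  by (simp add: doubling_tree_def joined_refl)

lemma doubling_tree_Suc:
  assumes tree: "doubling_tree x j S L"
    and L': "L' \<subseteq> nbrs L - S" "finite L'" "card L' = 2 ^ Suc j"
  shows "doubling_tree x (Suc j) (S \<union> L') L'"
proof -
  have "card (S \<union> L') < 2 ^ Suc (Suc j)"
    using card_Un_le[of S L'] tree L' by (simp add: doubling_tree_def)
  moreover have "joined E (S \<union> L') (Suc (Suc j)) x v" if v: "v \<in> L'" for v
  proof -
    obtain u where u: "u \<in> L" "E u v" "v \<notin> S" using L'(1) v by (auto simp: nbrs_def)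
    then have "joined E (S \<union> {v}) (Suc j + Suc 0) x v"
      using tree by (intro joined_append[of E S _ x u v] joined_refl) (auto simp: doubling_tree_def)
    then show ?thesis using v joined_mono[of E "S \<union> {v}" _ x v "S \<union> L'" E] by auto
  qed
  ultimately show ?thesis using tree L' by (simp add: doubling_tree_def)
qed

text \<open>The leaves have \<open>7 * 2 ^ j\<close> new neighbours, of which fewer than \<open>2 ^ j + 4 * 2 ^ j\<close> lie
  in the trees.\<close>
lemma expanding_grow_doubling_tree:
  assumes exp: "expanding 7 m W" and j: "2 ^ j \<le> m"
    and tree: "doubling_tree x j S L" and S: "S \<subseteq> V - W"
    and T: "finite T" "card T < 4 * 2 ^ j"
  obtains L' where "L' \<subseteq> V - (W \<union> T)" "doubling_tree x (Suc j) (S \<union> L') L'"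
proof -
  have L: "L \<subseteq> S" "card L = 2 ^ j" "card S < 2 * 2 ^ j" "finite S"
    using tree by (auto simp: doubling_tree_def)
  let ?N = "nbrs L - (W \<union> S \<union> T)"
  have "7 * 2 ^ j \<le> card (nbrs L - (W \<union> L))"
    using exp L S j unfolding expanding_def by (metis order_trans)
  also have "\<dots> \<le> card (?N \<union> ((S - L) \<union> T))"
    by (rule card_mono) (use finite_nbrs L T in auto)
  also have "\<dots> \<le> card ?N + (card (S - L) + card T)"
    by (meson card_Un_le add_left_mono order_trans)
  also have "card (S - L) = card S - card L"
    using L by (meson card_Diff_subset finite_subset)
  finally have "2 ^ Suc j \<le> card ?N" using L T by simp
  then obtain L' where L': "L' \<subseteq> ?N" "card L' = 2 ^ Suc j" "finite L'"
    by (rule obtain_subset_with_card_n)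
  then have "doubling_tree x (Suc j) (S \<union> L') L'"
    by (intro doubling_tree_Suc[OF tree]) auto
  moreover have "L' \<subseteq> V - (W \<union> T)" using L'(1) nbrs_subset by blast
  ultimately show thesis by (rule that[rotated])
qed

lemma expanding_ex_disjoint_doubling_trees:
  assumes exp: "expanding 7 m W" and xy: "x \<in> V - W" "y \<in> V - W" "x \<noteq> y" and j: "2 ^ j \<le> 2 * m"
  shows "\<exists>S L T M. doubling_tree x j S L \<and> doubling_tree y j T M \<and> S \<inter> T = {} \<and> S \<union> T \<subseteq> V - W"
  using j
proof (induction j)
  case 0
  have "{x} \<inter> {y} = {}" "{x} \<union> {y} \<subseteq> V - W" using xy by auto
  then show ?case using doubling_tree_0 by blast
next
  case (Suc j)
  have jm: "2 ^ j \<le> m" using Suc.prems by simp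
  then obtain S L T M where ST: "doubling_tree x j S L" "doubling_tree y j T M" "S \<inter> T = {}"
    "S \<union> T \<subseteq> V - W" using Suc.IH by auto
  obtain L' where L': "L' \<subseteq> V - (W \<union> T)" "doubling_tree x (Suc j) (S \<union> L') L'"
    using expanding_grow_doubling_tree[OF exp jm ST(1), of T] ST by (auto simp: doubling_tree_def)
  obtain M' where M': "M' \<subseteq> V - (W \<union> (S \<union> L'))" "doubling_tree y (Suc j) (T \<union> M') M'"
    using expanding_grow_doubling_tree[OF exp jm ST(2), of "S \<union> L'"] ST L'
    by (auto simp: doubling_tree_def)
  have "(S \<union> L') \<inter> (T \<union> M') = {}" "(S \<union> L') \<union> (T \<union> M') \<subseteq> V - W"
    using ST(3,4) L'(1) M'(1) by auto
  with L'(2) M'(2) show ?case by blast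
qed

end

section \<open>Bipartite graphs without large bipartite holes\<close>

locale bipartite_graph = finite_graph "A \<union> B" E for A B :: "'a set" and E +
  assumes disjoint: "A \<inter> B = {}" and opposite: "E u v \<Longrightarrow> u \<in> A \<longleftrightarrow> v \<in> B"
begin

definition side :: "bool \<Rightarrow> 'a set" where
  "side a = (if a then A else B)"

lemma edge_side: "E u v \<Longrightarrow> u \<in> side a \<Longrightarrow> v \<in> side (\<not> a)"
  using opposite[of u v] opposite[of v u] edge_sym[of u v] by (auto simp: side_def)

lemma side_subset: "side a \<subseteq> A \<union> B"
  by (simp add: side_def)

lemma ex_side: "u \<in> A \<union> B \<Longrightarrow> \<exists>a. u \<in> side a"
  by (auto simp: side_def)

lemma finite_side: "finite (side a)"
  using side_subset by (rule finite_if_subset_vertices)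

lemma card_eq_sum_sides:
  assumes "X \<subseteq> A \<union> B"
  shows "card X = card (X \<inter> side True) + card (X \<inter> side False)"
proof -
  have "card ((X \<inter> A) \<union> (X \<inter> B)) = card (X \<inter> A) + card (X \<inter> B)"
    using finite_if_subset_vertices[OF assms] disjoint by (intro card_Un_disjoint) auto
  then show ?thesis using assms by (simp add: side_def Int_Un_distrib[symmetric] inf.absorb1)
qed

lemma path_side:
  assumes "successively E p" "i + k < length p" "p ! i \<in> side a"
  shows "p ! (i + k) \<in> side (a \<longleftrightarrow> even k)"
  using assms(2)
proof (induction k)
  case (Suc k)
  then have "E (p ! (i + k)) (p ! (i + Suc k))" using assms(1) by (simp add: successively_conv_nth)
  then have "p ! (i + Suc k) \<in> side (\<not> (a \<longleftrightarrow> even k))" using Suc by (intro edge_side) simp_all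
  then show ?case by (simp add: not_iff)
qed (use assms(3) in simp)

lemma ex_start_on_side:
  assumes "successively E p" "set p \<subseteq> A \<union> B" "2 \<le> length p"
  obtains s where "s \<le> 1" "p ! s \<in> side a"
proof -
  have "p ! 0 \<in> set p" using assms(3) by (intro nth_mem) linarith
  then obtain b where b: "p ! 0 \<in> side b" using assms(2) ex_side by blast
  show thesis
  proof (cases "a = b")
    case True
    then show ?thesis using b by (intro that[of 0]) simp_all
  next
    case False
    have "p ! (0 + 1) \<in> side (b \<longleftrightarrow> even (1::nat))" using assms(1,3) b by (intro path_side) simp_all
    moreover have "(b \<longleftrightarrow> even (1::nat)) = a" using False by auto
    ultimately show ?thesis by (intro that[of 1]) simp_all
  qed
qed

lemma joined_side:
  assumes "joined E S n x y" "x \<in> side a"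
  shows "y \<in> side (a \<longleftrightarrow> odd n)"
proof -
  obtain p where p: "p \<noteq> []" "simple_path E p" "length p = n" "hd p = x" "last p = y"
    using assms(1) unfolding joined_def by blast
  then have "p ! (0 + (n - 1)) \<in> side (a \<longleftrightarrow> even (n - 1))"
    using assms(2) by (intro path_side) (auto simp: simple_path_def hd_conv_nth)
  then show ?thesis using p by (cases n) (auto simp: last_conv_nth)
qed

end

locale bipartite_hole_free = bipartite_graph A B E for A B :: "'a set" and E +
  fixes m :: nat
  assumes hole_free: "\<lbrakk>X \<subseteq> A; Y \<subseteq> B; m \<le> card X; m \<le> card Y\<rbrakk> \<Longrightarrow> \<exists>x\<in>X. \<exists>y\<in>Y. E x y"
begin

lemma m_pos: "0 < m"
  using hole_free[of "{}" "{}"] by auto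

lemma hole_free_sides:
  assumes "X \<subseteq> side a" "Y \<subseteq> side (\<not> a)" "\<And>x y. \<lbrakk>x \<in> X; y \<in> Y\<rbrakk> \<Longrightarrow> \<not> E x y"
  shows "card X < m \<or> card Y < m"
proof (cases a)
  case True
  then show ?thesis using hole_free[of X Y] assms by (fastforce simp: side_def)
next
  case False
  then show ?thesis using hole_free[of Y X] assms edge_sym by (fastforce simp: side_def)
qed

lemma card_non_nbrs_less:
  assumes "X \<subseteq> side a" "m \<le> card X" "Y \<subseteq> side (\<not> a)"
  shows "card (Y - nbrs X) < m"
proof -
  have "card X < m \<or> card (Y - nbrs X) < m"
    using assms(1,3) by (intro hole_free_sides) (auto simp: nbrs_def)
  then show ?thesis using assms(2) by simp
qed

lemma card_nbrs_greater:
  assumes X: "X \<subseteq> A \<union> B" "2 * m \<le> card X" and sides: "\<And>a. l + m \<le> card (side a)"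
  shows "l < card (nbrs X)"
proof -
  have "m \<le> card (X \<inter> side True) \<or> m \<le> card (X \<inter> side False)"
    using card_eq_sum_sides[OF X(1)] X(2) by linarith
  then obtain a where a: "m \<le> card (X \<inter> side a)" by blast
  have "card (side (\<not> a) - nbrs X) \<le> card (side (\<not> a) - nbrs (X \<inter> side a))"
    using finite_side by (intro card_mono) (auto simp: nbrs_def)
  also have "\<dots> < m" using a by (intro card_non_nbrs_less) auto
  finally have "card (side (\<not> a) - nbrs X) < m" .
  then show ?thesis
    using diff_card_le_card_Diff[OF finite_nbrs[of X], of "side (\<not> a)"] sides[of "\<not> a"]
    by linarith
qed

lemma ex_expanding_if_large_sides:
  assumes "\<And>a. (3 * k + 4) * m \<le> card (side a)"
  obtains W where "W \<subseteq> A \<union> B" "card W \<le> 2 * m" "expanding k m W"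
proof (rule ex_expanding[of "2 * m" m k])
  fix X assume X: "X \<subseteq> A \<union> B" "2 * m < card X" "card X \<le> 2 * m + m"
  have "Suc k * (3 * m) < card (nbrs X)"
    using X assms by (intro card_nbrs_greater) (auto simp: algebra_simps)
  moreover have "Suc k * card X \<le> Suc k * (3 * m)" using X by (intro mult_le_mono2) simp
  ultimately show "Suc k * card X < card (nbrs X)" by (rule le_less_trans[rotated])
qed (use that in auto)

lemma ex_side_nearly_avoiding:
  assumes D: "D \<subseteq> A \<union> B" and U: "U \<subseteq> A \<union> B" and same_card: "card D = card U"
    and no_edge: "\<And>x u. \<lbrakk>x \<in> D; u \<in> U\<rbrakk> \<Longrightarrow> \<not> E x u"
  obtains a where "card (D \<inter> side a) < m" "card (U \<inter> side a) < m"
proof (rule ccontr)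
  assume "\<not> thesis"
  then have many: "m \<le> card (D \<inter> side a) \<or> m \<le> card (U \<inter> side a)" for a
    using that by (meson not_less)
  have few: "card (D \<inter> side a) < m \<or> card (U \<inter> side (\<not> a)) < m" for a
    using no_edge by (intro hole_free_sides) auto
  show False
    using many[of True] many[of False] few[of True] few[of False]
      card_eq_sum_sides[OF D] card_eq_sum_sides[OF U] same_card
    by auto
qed

lemma ex_long_path:
  assumes Z: "finite Z" and sides: "\<And>a. l + card Z + 2 * m \<le> card (side a)"
  obtains p where "simple_path E p" "set p \<subseteq> A \<union> B - Z" "l \<le> length p"
proof -
  obtain p D U where p: "simple_path E p" "set p \<subseteq> A \<union> B - Z"
    and DU: "D \<subseteq> A \<union> B - Z" "U \<subseteq> A \<union> B - Z" "A \<union> B - Z \<subseteq> D \<union> U \<union> set p" "card D = card U"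
      "\<And>x u. \<lbrakk>x \<in> D; u \<in> U\<rbrakk> \<Longrightarrow> \<not> E x u"
    using ex_path_balanced_separation[of "A \<union> B - Z" E] finite_vertices symp_edges by auto
  have "D \<subseteq> A \<union> B" "U \<subseteq> A \<union> B" using DU by auto
  then obtain a where a: "card (D \<inter> side a) < m" "card (U \<inter> side a) < m"
    using ex_side_nearly_avoiding[of D U] DU(4,5) by blast
  have "side a \<subseteq> Z \<union> (D \<inter> side a) \<union> (U \<inter> side a) \<union> set p"
    using DU(3) side_subset[of a] by blast
  then have "card (side a) \<le> card (Z \<union> (D \<inter> side a) \<union> (U \<inter> side a) \<union> set p)"
    using Z finite_side by (intro card_mono) auto
  also have "\<dots> \<le> card (Z \<union> (D \<inter> side a) \<union> (U \<inter> side a)) + card (set p)" by (rule card_Un_le)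
  also have "card (Z \<union> (D \<inter> side a) \<union> (U \<inter> side a))
      \<le> card (Z \<union> (D \<inter> side a)) + card (U \<inter> side a)" by (rule card_Un_le)
  also have "card (Z \<union> (D \<inter> side a)) \<le> card Z + card (D \<inter> side a)" by (rule card_Un_le)
  finally have "l \<le> length p" using a sides[of a] card_length[of p] by linarith
  with p show thesis by (rule that)
qed

lemma card_indices_non_nbrs_less:
  assumes "X \<subseteq> side a" "m \<le> card X" "inj_on f K" "f ` K \<subseteq> side (\<not> a)"
  shows "card {k \<in> K. f k \<notin> nbrs X} < m"
proof -
  have "card {k \<in> K. f k \<notin> nbrs X} = card (f ` {k \<in> K. f k \<notin> nbrs X})"
    using assms(3) by (intro card_image[symmetric]) (auto simp: inj_on_def)
  also have "f ` {k \<in> K. f k \<notin> nbrs X} = f ` K - nbrs X" by auto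
  also have "card \<dots> < m" using assms by (intro card_non_nbrs_less)
  finally show ?thesis .
qed

text \<open>Of the \<open>2 * m\<close> candidate segments starting opposite to \<open>L\<close>, fewer than \<open>m\<close> have a wrong first
  vertex and fewer than \<open>m\<close> a wrong last vertex.\<close>
lemma ex_linking_segment:
  assumes p: "simple_path E p" "set p \<subseteq> A \<union> B" "4 * m + r \<le> length p"
    and L: "L \<subseteq> side a" "m \<le> card L" and M: "M \<subseteq> side (a \<longleftrightarrow> even r)" "m \<le> card M"
  obtains i where "i + r < length p" "p ! i \<in> nbrs L" "p ! (i + r) \<in> nbrs M"
proof -
  have path: "successively E p" "distinct p" using p(1) by (auto simp: simple_path_def)
  have "2 \<le> length p" using p(3) m_pos by linarith
  with path(1) p(2) obtain s where s: "s \<le> 1" "p ! s \<in> side (\<not> a)" by (rule ex_start_on_side)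
  have index: "s + (2 * k + q) < length p" if "k < 2 * m" "q \<le> r" for k q
    using that p(3) s(1) by linarith
  have on_side: "p ! (s + (2 * k + q)) \<in> side (a \<longleftrightarrow> odd q)" if "k < 2 * m" "q \<le> r" for k q
  proof -
    have "(\<not> a \<longleftrightarrow> even (2 * k + q)) = (a \<longleftrightarrow> odd q)" by auto
    then show ?thesis using path_side[OF path(1) index[OF that] s(2)] by simp
  qed
  have inj: "inj_on (\<lambda>k. p ! (s + (2 * k + q))) {..<2 * m}" if "q \<le> r" for q
    using path(2) index that by (auto simp: inj_on_def nth_eq_iff_index_eq)
  define bad where "bad q X = {k \<in> {..<2 * m}. p ! (s + (2 * k + q)) \<notin> nbrs X}" for q X
  have "card (bad 0 L) < m"
    unfolding bad_def using on_side[of _ 0] by (intro card_indices_non_nbrs_less[OF L] inj) auto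
  moreover have "card (bad r M) < m"
    unfolding bad_def using on_side[of _ r] by (intro card_indices_non_nbrs_less[OF M] inj) auto
  ultimately have "card (bad 0 L \<union> bad r M) < card {..<2 * m}"
    using card_Un_le[of "bad 0 L" "bad r M"] by simp
  then have "\<not> {..<2 * m} \<subseteq> bad 0 L \<union> bad r M"
    using card_mono[of "bad 0 L \<union> bad r M" "{..<2 * m}"] by (fastforce simp: bad_def)
  then obtain k where "k < 2 * m" "p ! (s + (2 * k + 0)) \<in> nbrs L" "p ! (s + (2 * k + r)) \<in> nbrs M"
    by (auto simp: bad_def)
  then show thesis using index by (intro that[of "s + 2 * k"]) (auto simp: add.assoc)
qed

lemma joined_via_doubling_trees:
  assumes trees: "doubling_tree x j S L" "doubling_tree y j T M" and "m \<le> 2 ^ j"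
    and sides: "x \<in> side a" "y \<in> side (a \<longleftrightarrow> even r)"
    and p: "simple_path E p" "set p \<subseteq> A \<union> B" "4 * m + r \<le> length p"
    and disj: "S \<inter> T = {}" "S \<inter> set p = {}" "T \<inter> set p = {}"
  shows "joined E (S \<union> set p \<union> T) (2 * j + r + 3) x y"
proof -
  have leaf: "joined E S (Suc j) x u" if "u \<in> L" for u
    using trees(1) that by (simp add: doubling_tree_def)
  have leaf': "joined E T (Suc j) y v" if "v \<in> M" for v
    using trees(2) that by (simp add: doubling_tree_def)
  have "((a \<longleftrightarrow> even r) \<longleftrightarrow> odd (Suc j)) = ((a \<longleftrightarrow> odd (Suc j)) \<longleftrightarrow> even r)" by auto
  then have "L \<subseteq> side (a \<longleftrightarrow> odd (Suc j))" "M \<subseteq> side ((a \<longleftrightarrow> odd (Suc j)) \<longleftrightarrow> even r)"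
    using joined_side[OF leaf sides(1)] joined_side[OF leaf' sides(2)] by auto
  moreover have "m \<le> card L" "m \<le> card M" using trees assms(3) by (auto simp: doubling_tree_def)
  ultimately obtain i where i: "i + r < length p" "p ! i \<in> nbrs L" "p ! (i + r) \<in> nbrs M"
    using ex_linking_segment[OF p] by metis
  then obtain u v where uv: "u \<in> L" "E u (p ! i)" "v \<in> M" "E (p ! (i + r)) v"
    using edge_sym by (auto simp: nbrs_def)
  have "joined E (S \<union> set p) (Suc j + Suc r) x (p ! (i + r))"
    using leaf[OF uv(1)] uv(2) joined_segment[OF p(1) i(1)] disj(2) by (rule joined_append)
  moreover have "joined E T (Suc j) v y" using symp_edges leaf'[OF uv(3)] by (rule joined_sym)
  moreover have "(S \<union> set p) \<inter> T = {}" using disj by blast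
  ultimately have "joined E (S \<union> set p \<union> T) ((Suc j + Suc r) + Suc j) x y"
    using uv(4) joined_append by metis
  moreover have "(Suc j + Suc r) + Suc j = 2 * j + r + 3" by simp
  ultimately show ?thesis by metis
qed

lemma joined_if_expanding:
  assumes card_sides: "\<And>a. 17 * m \<le> card (side a)"
    and W: "finite W" "card W \<le> 2 * m" "expanding 7 m W"
    and xy: "x \<in> side a - W" "y \<in> side (a \<longleftrightarrow> odd n) - W" "x \<noteq> y"
    and d: "2 * m \<le> 2 ^ d" and n: "2 * d < n" "n \<le> m"
  shows "joined E (A \<union> B) n x y"
proof -
  have "1 \<le> 2 * m - 1" using m_pos by linarith
  then obtain j where "2 ^ j \<le> 2 * m - 1" "2 * m - 1 < 2 ^ (j + 1)"
    using ex_power_ivl1[of 2 "2 * m - 1"] by blast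
  then have j: "m \<le> 2 ^ j" "2 ^ j < 2 * m" using m_pos by auto
  have "(2::nat) ^ j < 2 ^ d" using j(2) d by (rule less_le_trans)
  then have "j < d" by simp
  then obtain r where r: "n = 2 * j + r + 3" using n(1) by (auto simp: less_iff_Suc_add)
  have "x \<in> A \<union> B - W" "y \<in> A \<union> B - W" using xy side_subset by auto
  then obtain S L T M where trees: "doubling_tree x j S L" "doubling_tree y j T M"
    and ST: "S \<inter> T = {}" "S \<union> T \<subseteq> A \<union> B - W"
    using expanding_ex_disjoint_doubling_trees[OF W(3), of x y j] xy(3) j(2) by auto
  have fin: "finite S" "finite T" and "card S < 4 * m" "card T < 4 * m"
    using trees j(2) by (auto simp: doubling_tree_def)
  then have "card (W \<union> S \<union> T) \<le> 10 * m"
    using card_Un_le[of "W \<union> S" T] card_Un_le[of W S] W(2) by linarith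
  then have "5 * m + card (W \<union> S \<union> T) + 2 * m \<le> card (side b)" for b
    using card_sides[of b] by linarith
  then obtain p where p: "simple_path E p" "set p \<subseteq> A \<union> B - (W \<union> S \<union> T)" "5 * m \<le> length p"
    using ex_long_path[of "W \<union> S \<union> T" "5 * m"] W(1) fin by blast
  have "joined E (S \<union> set p \<union> T) (2 * j + r + 3) x y"
    using xy p ST r n(2) by (intro joined_via_doubling_trees[OF trees j(1), of a]) auto
  moreover have "S \<union> set p \<union> T \<subseteq> A \<union> B" using p(2) ST(2) by blast
  ultimately show ?thesis unfolding r by (rule joined_mono)
qed

definition linked_outside :: "'a set \<Rightarrow> nat \<Rightarrow> bool" where
  "linked_outside W d \<longleftrightarrow> (\<forall>a n. \<forall>x\<in>side a - W. \<forall>y\<in>side (a \<longleftrightarrow> odd n) - W.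
     x \<noteq> y \<longrightarrow> 2 * d < n \<longrightarrow> n \<le> m \<longrightarrow> joined E (A \<union> B) n x y)"

lemma ex_linked_outside:
  assumes card_sides: "\<And>a. 25 * m \<le> card (side a)" and d: "2 * m \<le> 2 ^ d"
  obtains W where "finite W" "card W \<le> 2 * m" "linked_outside W d"
proof -
  have "(3 * 7 + 4) * m \<le> card (side a)" for a using card_sides[of a] by simp
  then obtain W where W: "W \<subseteq> A \<union> B" "card W \<le> 2 * m" "expanding 7 m W"
    by (rule ex_expanding_if_large_sides)
  have finW: "finite W" using W(1) by (rule finite_if_subset_vertices)
  have "17 * m \<le> card (side a)" for a using card_sides[of a] by simp
  then have "linked_outside W d"
    using joined_if_expanding[OF _ finW W(2,3) _ _ _ d] unfolding linked_outside_def by blast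
  with finW W(2) show thesis by (rule that)
qed

lemma contains_even_cycle:
  assumes card_sides: "\<And>a. 25 * m \<le> card (side a)"
    and d: "2 * m \<le> 2 ^ d" and n: "2 * d < n" "n \<le> m" "even n"
  shows "contains_cycle E (A \<union> B) n"
proof -
  obtain W where W: "finite W" "card W \<le> 2 * m" "linked_outside W d"
    using card_sides d by (rule ex_linked_outside)
  have "m \<le> card (side a - W)" for a
    using diff_card_le_card_Diff[OF W(1), of "side a"] W(2) card_sides[of a] by linarith
  from this[of True] this[of False] obtain x y where xy: "x \<in> A - W" "y \<in> B - W" "E x y"
    using hole_free[of "A - W" "B - W"] by (auto simp: side_def)
  then have "joined E (A \<union> B) n x y"
    using W(3)[unfolded linked_outside_def, rule_format, of x True y n] n disjoint
    by (auto simp: side_def)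
  with edge_sym[OF xy(3)] show ?thesis unfolding contains_cycle_def by blast
qed

lemma contains_odd_cycle:
  assumes card_sides: "\<And>a. 25 * m \<le> card (side a)"
    and d: "2 * m \<le> 2 ^ d" and n: "2 * d < n" "n \<le> m" "odd n"
    and Q: "\<And>u v. E u v \<Longrightarrow> Q u v"
    and edge_in_large: "\<And>X. \<lbrakk>X \<subseteq> A; card A \<le> card X + 2 * m\<rbrakk> \<Longrightarrow> \<exists>x\<in>X. \<exists>y\<in>X. x \<noteq> y \<and> Q x y"
  shows "contains_cycle Q (A \<union> B) n"
proof -
  obtain W where W: "finite W" "card W \<le> 2 * m" "linked_outside W d"
    using card_sides d by (rule ex_linked_outside)
  have "card A \<le> card (A - W) + 2 * m"
    using diff_card_le_card_Diff[OF W(1), of A] W(2) by linarith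
  then obtain x y where xy: "y \<in> A - W" "x \<in> A - W" "y \<noteq> x" "Q y x"
    using edge_in_large[of "A - W"] by auto
  then have "joined E (A \<union> B) n x y"
    using W(3)[unfolded linked_outside_def, rule_format, of x True y n] n by (simp add: side_def)
  then have "joined Q (A \<union> B) n x y" using order_refl Q by (rule joined_mono)
  with xy(4) show ?thesis unfolding contains_cycle_def by blast
qed

end

section \<open>Cycles or bicliques\<close>

definition contains_biclique :: "('a \<Rightarrow> 'a \<Rightarrow> bool) \<Rightarrow> 'a set \<Rightarrow> nat \<Rightarrow> bool" where
  "contains_biclique R V m \<longleftrightarrow> (\<exists>A B. A \<subseteq> V \<and> B \<subseteq> V \<and> A \<inter> B = {} \<and> card A = m \<and> card B = m \<and>
     (\<forall>a\<in>A. \<forall>b\<in>B. R a b))"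

lemma contains_bicliqueI:
  assumes "A \<subseteq> V" "B \<subseteq> V" "A \<inter> B = {}" "m \<le> card A" "m \<le> card B"
    and "\<And>a b. \<lbrakk>a \<in> A; b \<in> B\<rbrakk> \<Longrightarrow> R a b"
  shows "contains_biclique R V m"
proof -
  obtain A' where A': "A' \<subseteq> A" "card A' = m" using assms(4) by (rule obtain_subset_with_card_n)
  obtain B' where B': "B' \<subseteq> B" "card B' = m" using assms(5) by (rule obtain_subset_with_card_n)
  have "A' \<subseteq> V" "B' \<subseteq> V" "A' \<inter> B' = {}" using A'(1) B'(1) assms(1-3) by auto
  moreover have "\<forall>a\<in>A'. \<forall>b\<in>B'. R a b" using A'(1) B'(1) assms(6) by blast
  ultimately show ?thesis using A'(2) B'(2) unfolding contains_biclique_def by blast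
qed

lemma contains_biclique_mono:
  assumes "contains_biclique R V m" "\<And>u v. \<lbrakk>u \<in> V; v \<in> V; u \<noteq> v; R u v\<rbrakk> \<Longrightarrow> S u v"
  shows "contains_biclique S V m"
proof -
  obtain A B where AB: "A \<subseteq> V" "B \<subseteq> V" "A \<inter> B = {}" "card A = m" "card B = m"
    and R: "\<forall>a\<in>A. \<forall>b\<in>B. R a b"
    using assms(1) unfolding contains_biclique_def by blast
  have "S a b" if "a \<in> A" "b \<in> B" for a b
    using AB(1-3) R that by (intro assms(2)) auto
  then show ?thesis using AB unfolding contains_biclique_def by blast
qed

lemma contains_biclique_if_complete:
  assumes "finite V" "2 * m \<le> card V" "\<And>u v. R u v"
  shows "contains_biclique R V m"
proof -
  have "m \<le> card V" using assms(2) by simp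
  then obtain A where A: "A \<subseteq> V" "card A = m" "finite A" by (rule obtain_subset_with_card_n)
  moreover have "m \<le> card (V - A)" using A assms(2) by (simp add: card_Diff_subset)
  ultimately show ?thesis using assms(3) by (intro contains_bicliqueI[of A _ "V - A"]) auto
qed

lemma ex_edge_if_no_biclique:
  assumes "\<not> contains_biclique (\<lambda>u v. P u v \<and> \<not> Q u v) V m"
    and XY: "X \<subseteq> V" "Y \<subseteq> V" "X \<inter> Y = {}" "m \<le> card X" "m \<le> card Y"
    and P: "\<forall>x\<in>X. \<forall>y\<in>Y. P x y"
  shows "\<exists>x\<in>X. \<exists>y\<in>Y. Q x y"
proof (rule ccontr)
  assume "\<not> ?thesis"
  with XY P have "contains_biclique (\<lambda>u v. P u v \<and> \<not> Q u v) V m"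
    by (intro contains_bicliqueI[of X _ Y]) auto
  with assms(1) show False by (rule notE)
qed

lemma ex_edge_inside_if_no_biclique:
  assumes no_biclique: "\<not> contains_biclique (\<lambda>u v. P u v \<and> \<not> Q u v) V m"
    and X: "X \<subseteq> V" "contains_biclique P X m"
  shows "\<exists>x\<in>X. \<exists>y\<in>X. x \<noteq> y \<and> Q x y"
proof -
  obtain Y Z where YZ: "Y \<subseteq> X" "Z \<subseteq> X" "Y \<inter> Z = {}" "card Y = m" "card Z = m"
    "\<forall>y\<in>Y. \<forall>z\<in>Z. P y z" using X(2) unfolding contains_biclique_def by blast
  have "Y \<subseteq> V" "Z \<subseteq> V" using YZ(1,2) X(1) by auto
  then have "\<exists>y\<in>Y. \<exists>z\<in>Z. Q y z"
    using YZ(3-6) by (intro ex_edge_if_no_biclique[OF no_biclique]) simp_all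
  then obtain y z where yz: "y \<in> Y" "z \<in> Z" "Q y z" by blast
  then have "y \<in> X" "z \<in> X" "y \<noteq> z" using YZ(1-3) by auto
  then show ?thesis using yz(3) by (intro bexI conjI)
qed

definition edges_between :: "('a \<Rightarrow> 'a \<Rightarrow> bool) \<Rightarrow> 'a set \<Rightarrow> 'a set \<Rightarrow> 'a \<Rightarrow> 'a \<Rightarrow> bool" where
  "edges_between Q A B u v \<longleftrightarrow> (u \<in> A \<and> v \<in> B \<or> u \<in> B \<and> v \<in> A) \<and> Q u v"

lemma bipartite_hole_free_edges_between:
  assumes "finite A" "finite B" "A \<inter> B = {}" "symp Q"
    and edge: "\<And>X Y. \<lbrakk>X \<subseteq> A; Y \<subseteq> B; m \<le> card X; m \<le> card Y\<rbrakk> \<Longrightarrow> \<exists>x\<in>X. \<exists>y\<in>Y. Q x y"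
  shows "bipartite_hole_free A B (edges_between Q A B) m"
proof
  show "symp (edges_between Q A B)"
    using sympD[OF assms(4)] by (auto simp: edges_between_def intro: sympI)
  show "\<exists>x\<in>X. \<exists>y\<in>Y. edges_between Q A B x y"
    if XY: "X \<subseteq> A" "Y \<subseteq> B" "m \<le> card X" "m \<le> card Y" for X Y
    using edge[OF XY] XY(1,2) unfolding edges_between_def by blast
qed (use assms(1-3) in \<open>auto simp: edges_between_def\<close>)

lemma contains_cycle_if_no_biclique_step:
  assumes "finite V" "symp Q"
    and large: "contains_biclique P V k" "25 * m \<le> k"
    and small: "\<And>U. \<lbrakk>U \<subseteq> V; k \<le> card U + 2 * m\<rbrakk> \<Longrightarrow> contains_biclique P U m"
    and d: "2 * m \<le> 2 ^ d" and n: "2 * d < n" "n \<le> m"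
    and no_biclique: "\<not> contains_biclique (\<lambda>u v. P u v \<and> \<not> Q u v) V m"
  shows "contains_cycle Q V n"
proof -
  obtain A B where AB: "A \<subseteq> V" "B \<subseteq> V" "A \<inter> B = {}" "card A = k" "card B = k"
    and P: "\<forall>a\<in>A. \<forall>b\<in>B. P a b"
    using large(1) unfolding contains_biclique_def by blast
  have "finite A" "finite B" using AB(1,2) assms(1) by (auto intro: finite_subset)
  then interpret bipartite_hole_free A B "edges_between Q A B" m
  proof (rule bipartite_hole_free_edges_between[OF _ _ AB(3) assms(2)])
    show "\<exists>x\<in>X. \<exists>y\<in>Y. Q x y" if "X \<subseteq> A" "Y \<subseteq> B" "m \<le> card X" "m \<le> card Y" for X Y
    proof (rule ex_edge_if_no_biclique[OF no_biclique])
      show "X \<subseteq> V" "Y \<subseteq> V" "X \<inter> Y = {}" using that(1,2) AB(1-3) by auto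
      show "\<forall>x\<in>X. \<forall>y\<in>Y. P x y" using that(1,2) P by blast
    qed (fact that(3,4))+
  qed
  have card_sides: "25 * m \<le> card (side a)" for a using AB large(2) by (simp add: side_def)
  have Q: "Q u v" if "edges_between Q A B u v" for u v using that by (simp add: edges_between_def)
  have "contains_cycle Q (A \<union> B) n"
  proof (cases "even n")
    case True
    then have "contains_cycle (edges_between Q A B) (A \<union> B) n"
      by (rule contains_even_cycle[OF card_sides d n])
    then show ?thesis using Q by (rule contains_cycle_mono[OF _ order_refl])
  next
    case False
    have edge_in_large: "\<exists>x\<in>X. \<exists>y\<in>X. x \<noteq> y \<and> Q x y"
      if X: "X \<subseteq> A" "card A \<le> card X + 2 * m" for X
    proof (rule ex_edge_inside_if_no_biclique[OF no_biclique])
      show "X \<subseteq> V" using X(1) AB(1) by blast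
      moreover have "k \<le> card X + 2 * m" using X(2) AB(4) by simp
      ultimately show "contains_biclique P X m" by (rule small)
    qed
    show ?thesis using Q edge_in_large by (rule contains_odd_cycle[OF card_sides d n False])
  qed
  moreover have "A \<union> B \<subseteq> V" using AB(1,2) by blast
  ultimately show ?thesis by (rule contains_cycle_mono)
qed

definition threshold :: "nat \<Rightarrow> nat" where
  "threshold t = 2 * 26 ^ (2 ^ t - 1)"

lemma threshold_Suc: "threshold (Suc t) = 13 * threshold t * threshold t"
proof -
  obtain s where "(2::nat) ^ t = Suc s" using gr0_conv_Suc[of "2 ^ t"] by auto
  then show ?thesis by (simp add: threshold_def power_add mult_2)
qed

lemma threshold_ge_2: "2 \<le> threshold t"
  by (simp add: threshold_def)

lemma threshold_le_Suc: "threshold t \<le> threshold (Suc t)"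
  unfolding threshold_def by (intro mult_le_mono2 power_increasing diff_le_mono) simp_all

lemma threshold_le:
  assumes "2 \<le> t"
  shows "threshold t \<le> 32 * 35 ^ (2 ^ t - 2)"
proof -
  have "(2::nat) ^ 2 \<le> 2 ^ t" using assms by (intro power_increasing) simp_all
  then obtain s :: nat where s: "2 ^ t = 4 + s" by (auto simp: le_iff_add)
  have "threshold t = 35152 * 26 ^ s" by (simp add: threshold_def s power_add)
  also have "\<dots> \<le> 39200 * 35 ^ s" by (intro mult_le_mono power_mono) simp_all
  also have "\<dots> = 32 * 35 ^ (2 ^ t - 2)" by (simp add: s power_add)
  finally show ?thesis .
qed

lemma contains_biclique_if_no_cycles:
  assumes "finite V" "\<And>i. i < t \<Longrightarrow> symp (R i)"
    and "threshold t * m \<le> card V" "threshold t * m \<le> 2 ^ d"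
    and "\<And>i. i < t \<Longrightarrow> 2 * d < n i \<and> n i \<le> m"
    and "\<And>i. i < t \<Longrightarrow> \<not> contains_cycle (R i) V (n i)"
  shows "contains_biclique (\<lambda>u v. \<forall>i<t. \<not> R i u v) V m"
  using assms
proof (induction t arbitrary: V m)
  case 0
  then show ?case by (simp add: threshold_def contains_biclique_if_complete)
next
  case (Suc t)
  let ?P = "\<lambda>u v. \<forall>i<t. \<not> R i u v" and ?k = "13 * threshold t * m"
  have "2 * m \<le> threshold t * m" using threshold_ge_2 by (rule mult_le_mono1)
  then have k: "26 * m \<le> ?k" "threshold t * m + 2 * m \<le> ?k" by linarith+
  have threshold_k: "threshold t * ?k = threshold (Suc t) * m" by (simp add: threshold_Suc)
  have d: "threshold t * m \<le> 2 ^ d"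
    using mult_le_mono1[OF threshold_le_Suc] Suc.prems(4) by (rule le_trans)
  have IH: "contains_biclique ?P U l"
    if "U \<subseteq> V" "threshold t * l \<le> card U" "threshold t * l \<le> 2 ^ d" "m \<le> l" for U l
  proof (rule Suc.IH)
    show "finite U" using that(1) Suc.prems(1) by (rule finite_subset)
    show "\<not> contains_cycle (R i) U (n i)" if "i < t" for i
      using Suc.prems(6)[of i] contains_cycle_mono[OF _ \<open>U \<subseteq> V\<close>] that by (metis less_SucI)
    show "symp (R i)" "2 * d < n i \<and> n i \<le> l" if "i < t" for i
      using Suc.prems(2,5)[of i] \<open>m \<le> l\<close> that by auto
  qed (fact that(2,3))+
  have "contains_biclique (\<lambda>u v. ?P u v \<and> \<not> R t u v) V m"
  proof (rule ccontr)
    assume no_biclique: "\<not> ?thesis"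
    have "contains_cycle (R t) V (n t)"
    proof (rule contains_cycle_if_no_biclique_step[OF Suc.prems(1) _ _ _ _ _ _ _ no_biclique])
      show "contains_biclique ?P V ?k"
        using order_refl Suc.prems(3,4)[folded threshold_k] by (rule IH) (use k(1) in linarith)
      show "contains_biclique ?P U m" if "U \<subseteq> V" "?k \<le> card U + 2 * m" for U
        using that(1) _ d order_refl by (rule IH) (use that(2) k(2) in linarith)
      show "25 * m \<le> ?k" "2 * m \<le> 2 ^ d" using k(1) d \<open>2 * m \<le> threshold t * m\<close> by linarith+
      show "symp (R t)" "2 * d < n t" "n t \<le> m" using Suc.prems(2,5)[of t] by auto
    qed
    then show False using Suc.prems(6)[of t] by simp
  qed
  then show ?case by (simp add: All_less_Suc conj_commute)
qed

section \<open>The Ramsey number\<close>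

lemma has_mono_copy_cycle_graph:
  assumes "contains_cycle (\<lambda>u v. c {u, v} = i) {..<N} n"
  shows "has_mono_copy N c (cycle_graph n) i"
proof -
  obtain p where p: "p \<noteq> []" "distinct p" "set p \<subseteq> {..<N}" "length p = n"
    and adj: "successively (\<lambda>u v. c {u, v} = i) p" "c {last p, hd p} = i"
    using assms unfolding contains_cycle_def joined_def simple_path_def by blast
  have next_colour: "c {p ! u, p ! ((u + 1) mod n)} = i" if "u < n" for u
  proof (cases "u + 1 < n")
    case True
    then show ?thesis using adj(1) p(4) by (simp add: successively_conv_nth)
  next
    case False
    then have "u + 1 = n" using that by simp
    then show ?thesis using adj(2) p(1,4) by (auto simp: last_conv_nth hd_conv_nth)
  qed
  have "inj_on ((!) p) {..<n}" using p(2,4) by (auto simp: inj_on_def nth_eq_iff_index_eq)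
  moreover have "(!) p ` {..<n} \<subseteq> {..<N}" using p(3,4) by (auto dest: nth_mem)
  moreover have "c {p ! u, p ! v} = i"
    if "u < n" "v < n" "v = (u + 1) mod n \<or> u = (v + 1) mod n" for u v
    using next_colour[of u] next_colour[of v] that by (auto simp: insert_commute)
  ultimately show ?thesis
    unfolding has_mono_copy_def cycle_graph_def by (intro exI[of _ "(!) p"]) auto
qed

lemma has_mono_copy_complete_bipartite:
  assumes "contains_biclique (\<lambda>u v. c {u, v} = i) {..<N} m" "a \<le> m" "b \<le> m"
  shows "has_mono_copy N c (complete_bipartite a b) i"
proof -
  obtain A B where AB: "A \<subseteq> {..<N}" "B \<subseteq> {..<N}" "A \<inter> B = {}" "card A = m" "card B = m"
    and colour: "\<forall>u\<in>A. \<forall>v\<in>B. c {u, v} = i"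
    using assms(1) unfolding contains_biclique_def by blast
  have fin: "finite A" "finite B" using AB(1,2) finite_subset by blast+
  obtain f where f: "f ` {..<a} \<subseteq> A" "inj_on f {..<a}"
    using card_le_inj[of "{..<a}" A] fin(1) AB(4) assms(2) by auto
  obtain g where g: "g ` {a..<a + b} \<subseteq> B" "inj_on g {a..<a + b}"
    using card_le_inj[of "{a..<a + b}" B] fin(2) AB(5) assms(3) by auto
  define h where "h = (\<lambda>u. if u \<in> {..<a} then f u else g u)"
  have h_A: "h u \<in> A" if "u < a" for u using f(1) that by (auto simp: h_def)
  have h_B: "h v \<in> B" if "a \<le> v" "v < a + b" for v using g(1) that by (auto simp: h_def)
  have split: "{..<a + b} = {..<a} \<union> {a..<a + b}" by auto
  have "f ` {..<a} \<inter> g ` {a..<a + b} = {}" using f(1) g(1) AB(3) by blast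
  with f(2) g(2) have "inj_on h {..<a + b}" unfolding split h_def by (rule inj_on_disjoint_Un)
  moreover have "h ` {..<a + b} \<subseteq> A \<union> B"
    unfolding split image_Un using h_A h_B by (intro Un_mono image_subsetI) auto
  then have "h ` {..<a + b} \<subseteq> {..<N}" using AB(1,2) by blast
  moreover have "c {h u, h v} = i" "c {h v, h u} = i" if "u < a" "a \<le> v" "v < a + b" for u v
    using colour h_A[OF that(1)] h_B[OF that(2,3)] by (simp_all add: insert_commute)
  ultimately show ?thesis
    unfolding has_mono_copy_def complete_bipartite_def by (intro exI[of _ h]) simp
qed

lemma ramsey_prop_cycles_complete_bipartite:
  assumes "threshold t * m \<le> N" "N \<le> 2 ^ d" and n: "\<And>i. i < t \<Longrightarrow> 2 * d < n i \<and> n i \<le> m"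
    and ab: "a \<le> m" "b \<le> m"
  shows "ramsey_prop (map (\<lambda>i. cycle_graph (n i)) [0..<t] @ [complete_bipartite a b]) N"
    (is "ramsey_prop ?Gs N")
  unfolding ramsey_prop_def
proof (intro allI impI)
  fix c :: "nat set \<Rightarrow> nat"
  assume c: "\<forall>x<N. \<forall>y<N. x \<noteq> y \<longrightarrow> c {x, y} < length ?Gs"
  let ?R = "\<lambda>i u v. c {u, v} = i"
  show "\<exists>i<length ?Gs. has_mono_copy N c (?Gs ! i) i"
  proof (cases "\<exists>i<t. contains_cycle (?R i) {..<N} (n i)")
    case True
    then obtain i where "i < t" "contains_cycle (?R i) {..<N} (n i)" by blast
    then have "i < length ?Gs" "has_mono_copy N c (?Gs ! i) i"
      by (auto simp: nth_append intro: has_mono_copy_cycle_graph)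
    then show ?thesis by blast
  next
    case False
    then have "contains_biclique (\<lambda>u v. \<forall>i<t. \<not> ?R i u v) {..<N} m"
      using assms by (intro contains_biclique_if_no_cycles[where d = d and n = n])
        (auto intro: sympI simp: insert_commute)
    then have "contains_biclique (?R t) {..<N} m"
    proof (rule contains_biclique_mono)
      fix u v assume uv: "u \<in> {..<N}" "v \<in> {..<N}" "u \<noteq> v" "\<forall>i<t. c {u, v} \<noteq> i"
      then have "c {u, v} < Suc t" using c by simp
      then show "c {u, v} = t" using uv(4) by (auto simp: less_Suc_eq)
    qed
    then have "has_mono_copy N c (?Gs ! t) t"
      using ab by (simp add: nth_append has_mono_copy_complete_bipartite)
    then show ?thesis by (intro exI[of _ t]) simp
  qed
qed

lemma le_two_power_ceiling_log:
  fixes x :: real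
  assumes "0 < x"
  shows "x \<le> 2 ^ nat \<lceil>log 2 x\<rceil>"
proof -
  have "log 2 x \<le> real (nat \<lceil>log 2 x\<rceil>)" by linarith
  then show ?thesis using assms by (simp add: log_le_iff powr_realpow)
qed

theorem theorem2p11:
  fixes t m1 m2 :: nat and n :: "nat \<Rightarrow> nat"
  assumes "t \<ge> 2" and "m1 > 0" and "m2 > 0"
    and "\<And>i. i \<in> {1..t} \<Longrightarrow> n i > 0"
    and "\<And>i. i \<in> {1..t} \<Longrightarrow> m2 \<ge> n i"
    and "\<And>i. i \<in> {1..t} \<Longrightarrow>
           int (n i) \<ge> 2 * \<lceil>log 2 (real (35 ^ (2 ^ t - 2) * (32 * m1 + 49 * m2)))\<rceil> + 2"
  shows "ramsey_number (map (\<lambda>i. cycle_graph (n i)) [1..<t+1] @ [complete_bipartite m1 m2])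
           \<le> 35 ^ (2 ^ t - 2) * (32 * m1 + 49 * m2)"
proof -
  define N where "N = 35 ^ (2 ^ t - 2) * (32 * m1 + 49 * m2)"
  define m where "m = max m1 m2"
  define d where "d = nat \<lceil>log 2 (real N)\<rceil>"
  have "threshold t * m \<le> 32 * 35 ^ (2 ^ t - 2) * m"
    using threshold_le[OF assms(1)] by (rule mult_le_mono1)
  also have "\<dots> = 35 ^ (2 ^ t - 2) * (32 * m)" by simp
  also have "\<dots> \<le> N" unfolding N_def m_def by (intro mult_le_mono2) auto
  finally have N_ge: "threshold t * m \<le> N" .
  have "0 < real N" using assms(2) by (simp add: N_def)
  from le_two_power_ceiling_log[OF this] have "real N \<le> real (2 ^ d)" by (simp add: d_def)
  then have N_le: "N \<le> 2 ^ d" by (simp only: of_nat_le_iff)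
  have n: "2 * d < n (Suc i) \<and> n (Suc i) \<le> m" if "i < t" for i
    using assms(4,5,6)[of "Suc i"] that unfolding N_def[symmetric] d_def m_def by simp linarith
  have "map (\<lambda>i. cycle_graph (n i)) [1..<t+1] = map (\<lambda>i. cycle_graph (n (Suc i))) [0..<t]"
    by (simp add: map_Suc_upt[symmetric] del: upt_Suc)
  then have "ramsey_prop (map (\<lambda>i. cycle_graph (n i)) [1..<t+1] @ [complete_bipartite m1 m2]) N"
    using ramsey_prop_cycles_complete_bipartite[OF N_ge N_le n] by (simp add: m_def)
  then show ?thesis unfolding ramsey_number_def N_def by (rule Least_le)
qed

end
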